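(* For every integer $k\ge1$ and every $s=0,\dots,k$ the identity $$\sum_{m=1}^{s}\sum_{m,s}(1!)^{\alpha_1}\cdots(s!)^{\alpha_s}\,C_{\alpha_1,\dots,\alpha_s}^{s,m,k}=(2s-1)!!\binom{k+s-1}{2s}$$ holds.
   Context: $(-1)!!=1$. For integers $k\ge1$, $1\le s\le k-1$, $1\le m\le s$ and nonnegative integers $\alpha_1,\dots,\alpha_s$ with $\sum_{i=1}^s\alpha_i=m$, $\sum_{i=1}^s i\alpha_i=s$, the numbers $C_{\alpha_1,\dots,\alpha_s}^{s,m,k}$ are the uniquely determined universal numbers (not depending on $u$) such that for every entire or meromorphic function $u$ on $\mathbb{C}$ the operator $A=u(z)\frac{d}{dz}$ satisfies $$A^{k}=u^k\Big(\frac{d}{dz}\Big)^k+\sum_{s=1}^{k-1}\Big(\sum_{m=1}^{s}u^{k-m}\sum_{m,s}C_{\alpha_1,\dots,\alpha_s}^{s,m,k}\Big(\frac{du}{dz}\Big)^{\alpha_1}\cdots\Big(\frac{d^su}{dz^s}\Big)^{\alpha_s}\Big)\Big(\frac{d}{dz}\Big)^{k-s},$$ where $\sum_{m,s}$ is over all nonnegative integers $\alpha_1,\dots,\alpha_s$ with $\sum_{i=1}^s\alpha_i=m$ and $\sum_{i=1}^s i\alpha_i=s$. Conventions: for $s=0$ the double sum $\sum_{m=1}^{s}\sum_{m,s}$ is understood to equal $1$ (coefficient of $u^k(d/dz)^k$), and $C_{\alpha_1,\dots,\alpha_k}^{k,m,k}=0$ (the coefficient of $(d/dz)^0$ in $A^k$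 is $0$). *)

theory Defs
  imports "HOL-Complex_Analysis.Complex_Analysis"
begin

text \<open>The empty product gives \<open>(-1)!! = 0!! = 1\<close>.\<close>

definition double_fact :: "int \<Rightarrow> int" where
  "double_fact n = \<Prod>{j. 1 \<le> j \<and> j \<le> n \<and> even (n - j)}"

definition diff_op :: "(complex \<Rightarrow> complex) \<Rightarrow> (complex \<Rightarrow> complex) \<Rightarrow> complex \<Rightarrow> complex" where
  "diff_op u f = (\<lambda>z. u z * deriv f z)"

text \<open>A tuple \<open>(\<alpha>\<^sub>1, \<dots>, \<alpha>\<^sub>s)\<close> is represented by the function on \<open>nat\<close>
  that has these values on \<open>{1..s}\<close> and vanishes elsewhere.\<close>

definition multi_indices :: "nat \<Rightarrow> nat \<Rightarrow> (nat \<Rightarrow> nat) set" where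
  "multi_indices s m =
     {\<alpha>. (\<forall>i. i \<notin> {1..s} \<longrightarrow> \<alpha> i = 0) \<and>
         (\<Sum>i=1..s. \<alpha> i) = m \<and> (\<Sum>i=1..s. i * \<alpha> i) = s}"

text \<open>The operator identity, as an identity between meromorphic functions, is evaluated at
  every point where both the coefficient \<open>u\<close> and the argument \<open>f\<close> are analytic: at the
  remaining isolated points the values of a meromorphic function in the sense of
  \<open>meromorphic_on\<close> are arbitrary.  Entire \<open>u\<close> and \<open>f\<close> are included.\<close>

definition expands_power :: "nat \<Rightarrow> (nat \<Rightarrow> nat \<Rightarrow> (nat \<Rightarrow> nat) \<Rightarrow> complex) \<Rightarrow> bool" where
  "expands_power k c \<longleftrightarrow>
     (\<forall>u f z. u meromorphic_on UNIV \<longrightarrow> f meromorphic_on UNIV \<longrightarrow>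
        u analytic_on {z} \<longrightarrow> f analytic_on {z} \<longrightarrow>
        (diff_op u ^^ k) f z =
          u z ^ k * (deriv ^^ k) f z +
          (\<Sum>s=1..k-1.
             (\<Sum>m=1..s. u z ^ (k - m) *
                (\<Sum>\<alpha>\<in>multi_indices s m. c s m \<alpha> * (\<Prod>i=1..s. (deriv ^^ i) u z ^ \<alpha> i))) *
             (deriv ^^ (k - s)) f z))"

text \<open>\<open>coeff_C k s m \<alpha>\<close> is the number \<open>C\<close> with upper indices \<open>s, m, k\<close> and lower
  indices \<open>\<alpha>\<close>.  The identity only involves \<open>1 \<le> s \<le> k - 1\<close>, \<open>1 \<le> m \<le> s\<close> and
  \<open>\<alpha> \<in> multi_indices s m\<close>; all other values are set to \<open>0\<close>, which makes the family unique
  and contains the convention that the coefficients with \<open>s = k\<close> are \<open>0\<close>.\<close>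

definition coeff_C :: "nat \<Rightarrow> nat \<Rightarrow> nat \<Rightarrow> (nat \<Rightarrow> nat) \<Rightarrow> complex" where
  "coeff_C k = (THE c. expands_power k c \<and>
     (\<forall>s m \<alpha>. \<not> (1 \<le> s \<and> s \<le> k - 1 \<and> 1 \<le> m \<and> m \<le> s \<and> \<alpha> \<in> multi_indices s m) \<longrightarrow>
        c s m \<alpha> = 0))"

text \<open>The double sum over \<open>m\<close> and \<open>\<alpha>\<close>, equal to \<open>1\<close> by convention for \<open>s = 0\<close>
  (the coefficient of \<open>u\<^sup>k (d/dz)\<^sup>k\<close>).\<close>

definition double_sum :: "nat \<Rightarrow> (nat \<Rightarrow> (nat \<Rightarrow> nat) \<Rightarrow> complex) \<Rightarrow> complex" where
  "double_sum s F = (if s = 0 then 1 else (\<Sum>m=1..s. \<Sum>\<alpha>\<in>multi_indices s m. F m \<alpha>))"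

end

theory Submission
  imports Defs
begin

text \<open>The coefficients are universal, so they may be read off from one well-chosen \<open>u\<close>.  For
  \<open>u = 1 / (1 - z)\<close> the derivatives at \<open>0\<close> are \<open>u\<^sup>(\<^sup>i\<^sup>) = i!\<close>, so the sum in question is the
  coefficient of \<open>(d/dz)\<^sup>k\<^sup>-\<^sup>s\<close> in \<open>A\<^sup>k\<close> at \<open>0\<close>.  By homogeneity \<open>A\<^sup>k = \<Sum>\<^sub>s a(k, s) u\<^sup>k\<^sup>+\<^sup>s (d/dz)\<^sup>k\<^sup>-\<^sup>s\<close>, and \<open>u' = u\<^sup>2\<close> yields
  \<open>a(k + 1, s + 1) = a(k, s + 1) + (k + s) a(k, s)\<close>, which is Pascal's rule for the right-hand side.\<close>

subsection \<open>Existence of the expansion\<close>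

text \<open>\<open>homog d w Q\<close>: the function \<open>Q\<close> of a jet \<open>x 0, x 1, \<dots>\<close> is a differential polynomial, homogeneous
  of degree \<open>d\<close> and of weight \<open>w\<close>, where \<open>x i\<close> has weight \<open>i\<close>.\<close>

inductive homog :: "nat \<Rightarrow> nat \<Rightarrow> ((nat \<Rightarrow> complex) \<Rightarrow> complex) \<Rightarrow> bool" where
  homog_zero: "homog d w (\<lambda>x. 0)"
| homog_monomial: "size M = d \<Longrightarrow> sum_mset M = w \<Longrightarrow> homog d w (\<lambda>x. a * prod_mset (image_mset x M))"
| homog_add: "homog d w Q \<Longrightarrow> homog d w R \<Longrightarrow> homog d w (\<lambda>x. Q x + R x)"

lemma homog_times_var: "homog d w Q \<Longrightarrow> homog (Suc d) (i + w) (\<lambda>x. x i * Q x)"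
proof (induction rule: homog.induct)
  case (homog_zero d w)
  then show ?case by (simp add: homog.homog_zero)
next
  case (homog_monomial M d w a)
  then show ?case
    using homog.homog_monomial[of "add_mset i M" "Suc d" "i + w" a] by (simp add: mult_ac)
next
  case (homog_add d w Q R)
  then show ?case
    using homog.homog_add by (fastforce simp: distrib_left)
qed

lemma homog_cmult: "homog d w Q \<Longrightarrow> homog d w (\<lambda>x. a * Q x)"
proof (induction rule: homog.induct)
  case (homog_zero d w)
  then show ?case by (simp add: homog.homog_zero)
next
  case (homog_monomial M d w b)
  then show ?case
    using homog.homog_monomial[of M d w "a * b"] by (simp add: mult_ac)
next
  case (homog_add d w Q R)
  then show ?case
    using homog.homog_add by (fastforce simp: distrib_left)
qed

section \<open>Differentiation of differential polynomials along a jet\<close>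

lemma higher_deriv_has_field_derivative:
  assumes "f analytic_on {z}"
  shows "((deriv ^^ n) f has_field_derivative (deriv ^^ Suc n) f z) (at z)"
  using analytic_derivI[OF analytic_higher_deriv[OF assms, of n]] by simp

text \<open>Product rule: each summand of the derivative turns one factor \<open>x i\<close> into
  \<open>x (Suc i)\<close>, so the degree is kept and the weight grows by one. \<open>Q\<close> is
  chosen before \<open>u\<close> and \<open>z\<close>; this is what makes the coefficients
  universal.\<close>

lemma monomial_deriv:
  "\<exists>Q. homog (size M) (Suc (sum_mset M)) Q \<and>
     (\<forall>u z. u analytic_on {z} \<longrightarrow>
        ((\<lambda>y. \<Prod>i\<in>#M. (deriv ^^ i) u y) has_field_derivative Q (\<lambda>i. (deriv ^^ i) u z)) (at z))"
proof (induction M)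
  case empty
  show ?case
    by (rule exI[of _ "\<lambda>x. 0"]) (simp add: homog_zero)
next
  case (add i M)
  then obtain Q where Q: "homog (size M) (Suc (sum_mset M)) Q"
    and deriv_Q: "\<And>u z. u analytic_on {z} \<Longrightarrow>
      ((\<lambda>y. \<Prod>i\<in>#M. (deriv ^^ i) u y) has_field_derivative Q (\<lambda>i. (deriv ^^ i) u z)) (at z)"
    by blast
  let ?R = "\<lambda>x. x (Suc i) * (\<Prod>j\<in>#M. x j) + x i * Q x"
  have "homog (Suc (size M)) (Suc i + sum_mset M) (\<lambda>x. x (Suc i) * (1 * (\<Prod>j\<in>#M. x j)))"
    by (intro homog_times_var homog_monomial) auto
  moreover have "homog (Suc (size M)) (i + Suc (sum_mset M)) (\<lambda>x. x i * Q x)"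
    by (intro homog_times_var Q)
  ultimately have "homog (Suc (size M)) (Suc (i + sum_mset M)) ?R"
    using homog_add by fastforce
  moreover have "((\<lambda>y. (deriv ^^ i) u y * (\<Prod>j\<in>#M. (deriv ^^ j) u y)) has_field_derivative
      ?R (\<lambda>i. (deriv ^^ i) u z)) (at z)" if "u analytic_on {z}" for u z
    using DERIV_mult[OF higher_deriv_has_field_derivative[OF that, of i] deriv_Q[OF that]]
    by (simp add: mult_ac add_ac)
  ultimately show ?case
    by (intro exI[of _ ?R]) simp
qed

lemma homog_deriv:
  "homog d w Q \<Longrightarrow> \<exists>Q'. homog d (Suc w) Q' \<and>
     (\<forall>u z. u analytic_on {z} \<longrightarrow>
        ((\<lambda>y. Q (\<lambda>i. (deriv ^^ i) u y)) has_field_derivative Q' (\<lambda>i. (deriv ^^ i) u z)) (at z))"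
proof (induction rule: homog.induct)
  case (homog_zero d w)
  show ?case
    by (rule exI[of _ "\<lambda>x. 0"]) (simp add: homog.homog_zero)
next
  case (homog_monomial M d w a)
  obtain Q where "homog (size M) (Suc (sum_mset M)) Q"
    "\<And>u z. u analytic_on {z} \<Longrightarrow>
      ((\<lambda>y. \<Prod>i\<in>#M. (deriv ^^ i) u y) has_field_derivative Q (\<lambda>i. (deriv ^^ i) u z)) (at z)"
    using monomial_deriv by blast
  then show ?case
    using homog_monomial by (intro exI[of _ "\<lambda>x. a * Q x"]) (auto intro: homog_cmult DERIV_cmult)
next
  case (homog_add d w Q R)
  then obtain Q' R' where
    "homog d (Suc w) Q'" "homog d (Suc w) R'"
    "\<And>u z. u analytic_on {z} \<Longrightarrow>
      ((\<lambda>y. Q (\<lambda>i. (deriv ^^ i) u y)) has_field_derivative Q' (\<lambda>i. (deriv ^^ i) u z)) (at z)"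
    "\<And>u z. u analytic_on {z} \<Longrightarrow>
      ((\<lambda>y. R (\<lambda>i. (deriv ^^ i) u y)) has_field_derivative R' (\<lambda>i. (deriv ^^ i) u z)) (at z)"
    by blast
  then show ?case
    by (intro exI[of _ "\<lambda>x. Q' x + R' x"]) (auto intro: homog.homog_add DERIV_add)
qed

text \<open>Induction on the exponent by the product rule. One more application of A multiplies by
  \<open>x 0\<close>, raising the degree, and the derivative falls either on f, keeping s, or on the
  coefficient, raising the weight and s by one. Starting from A itself, no undifferentiated f ever
  appears, hence the range \<open>s \<le> n\<close> for the exponent \<open>Suc n\<close>.\<close>

lemma diff_op_power_homog:
  "\<exists>Q. (\<forall>x. Q 0 x = x 0 ^ Suc n) \<and> (\<forall>s\<le>n. homog (Suc n) s (Q s)) \<and>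
     (\<forall>u f z. u analytic_on {z} \<longrightarrow> f analytic_on {z} \<longrightarrow>
        (diff_op u ^^ Suc n) f z =
          (\<Sum>s\<le>n. Q s (\<lambda>i. (deriv ^^ i) u z) * (deriv ^^ (Suc n - s)) f z))"
proof (induction n)
  case 0
  have "homog 1 0 (\<lambda>x. x 0)"
    using homog_monomial[of "{#0#}" 1 0 1] by simp
  then show ?case
    by (intro exI[of _ "\<lambda>s x. x 0"]) (simp add: diff_op_def)
next
  case (Suc n)
  then obtain Q where Q0: "\<And>x. Q 0 x = x 0 ^ Suc n"
    and Q: "\<And>s. s \<le> n \<Longrightarrow> homog (Suc n) s (Q s)"
    and eq: "\<And>u f z. u analytic_on {z} \<Longrightarrow> f analytic_on {z} \<Longrightarrow>
        (diff_op u ^^ Suc n) f z =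
          (\<Sum>s\<le>n. Q s (\<lambda>i. (deriv ^^ i) u z) * (deriv ^^ (Suc n - s)) f z)"
    by blast
  from homog_deriv[OF Q] obtain D where D: "\<And>s. s \<le> n \<Longrightarrow> homog (Suc n) (Suc s) (D s)"
    and deriv_D: "\<And>s u z. s \<le> n \<Longrightarrow> u analytic_on {z} \<Longrightarrow>
        ((\<lambda>y. Q s (\<lambda>i. (deriv ^^ i) u y)) has_field_derivative D s (\<lambda>i. (deriv ^^ i) u z)) (at z)"
    by metis
  \<comment> \<open>The first summand collects the derivatives falling on f, the second those
    falling on the coefficient with index s - 1. The guard is there because nothing is known about
    \<open>Q (Suc n)\<close>.\<close>
  define R where "R = (\<lambda>s x. (if s \<le> n then x 0 * Q s x else 0) +
      (case s of 0 \<Rightarrow> 0 | Suc t \<Rightarrow> x 0 * D t x))"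
  have "homog (Suc (Suc n)) s (R s)" if "s \<le> Suc n" for s
  proof -
    have "homog (Suc (Suc n)) s (\<lambda>x. if s \<le> n then x 0 * Q s x else 0)"
      using homog_times_var[OF Q, of s 0] by (cases "s \<le> n") (simp_all add: homog_zero)
    moreover have "homog (Suc (Suc n)) s (\<lambda>x. case s of 0 \<Rightarrow> 0 | Suc t \<Rightarrow> x 0 * D t x)"
      using homog_times_var[OF D, of "s - 1" 0] that by (cases s) (simp_all add: homog_zero)
    ultimately show ?thesis
      unfolding R_def by (rule homog_add)
  qed
  moreover have "(diff_op u ^^ Suc (Suc n)) f z =
      (\<Sum>s\<le>Suc n. R s (\<lambda>i. (deriv ^^ i) u z) * (deriv ^^ (Suc (Suc n) - s)) f z)"
    if u: "u analytic_on {z}" and f: "f analytic_on {z}" for u f z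
  proof -
    let ?j = "\<lambda>y i. (deriv ^^ i) u y"
    let ?g = "\<lambda>y. \<Sum>s\<le>n. Q s (?j y) * (deriv ^^ (Suc n - s)) f y"
    \<comment> \<open>Analyticity at z extends to a neighbourhood, so the induction hypothesis
      becomes an equality of functions near z and may be differentiated.\<close>
    have "eventually (\<lambda>y. u analytic_on {y} \<and> f analytic_on {y}) (nhds z)"
    proof -
      obtain S where "open S" "z \<in> S" "u analytic_on S" "f analytic_on S"
        using u f by (metis (no_types, lifting) analytic_at analytic_on_open analytic_on_subset
          inf.cobounded1 inf.cobounded2 IntI open_Int)
      then show ?thesis
        unfolding eventually_nhds by (meson analytic_on_subset empty_subsetI insert_subset)
    qed
    then have "eventually (\<lambda>y. (diff_op u ^^ Suc n) f y = ?g y) (nhds z)"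
      by eventually_elim (use eq in blast)
    from deriv_cong_ev[OF this refl] have "deriv ((diff_op u ^^ Suc n) f) z = deriv ?g z" .
    moreover have "(?g has_field_derivative
        (\<Sum>s\<le>n. Q s (?j z) * (deriv ^^ Suc (Suc n - s)) f z + D s (?j z) * (deriv ^^ (Suc n - s)) f z)) (at z)"
      by (intro DERIV_sum DERIV_mult' deriv_D higher_deriv_has_field_derivative u f) auto
    ultimately have deriv_eq: "deriv ((diff_op u ^^ Suc n) f) z =
        (\<Sum>s\<le>n. Q s (?j z) * (deriv ^^ Suc (Suc n - s)) f z + D s (?j z) * (deriv ^^ (Suc n - s)) f z)"
      by (simp only: DERIV_imp_deriv)
    have "(diff_op u ^^ Suc (Suc n)) f z = u z * deriv ((diff_op u ^^ Suc n) f) z"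
      by (subst funpow.simps(2)) (simp only: o_apply diff_op_def[of u "(diff_op u ^^ Suc n) f"])
    also have "\<dots> =
        (\<Sum>s\<le>n. u z * Q s (?j z) * (deriv ^^ Suc (Suc n - s)) f z) +
        (\<Sum>s\<le>n. u z * D s (?j z) * (deriv ^^ (Suc n - s)) f z)"
      unfolding deriv_eq by (simp only: distrib_left sum.distrib sum_distrib_left mult.assoc)
    also have "(\<Sum>s\<le>n. u z * Q s (?j z) * (deriv ^^ Suc (Suc n - s)) f z) =
        (\<Sum>s\<le>Suc n. (if s \<le> n then u z * Q s (?j z) else 0) * (deriv ^^ (Suc (Suc n) - s)) f z)"
    proof -
      have "(\<Sum>s\<le>n. u z * Q s (?j z) * (deriv ^^ Suc (Suc n - s)) f z) =
          (\<Sum>s\<le>n. (if s \<le> n then u z * Q s (?j z) else 0) * (deriv ^^ (Suc (Suc n) - s)) f z)"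
        by (rule sum.cong) (simp_all add: Suc_diff_le del: funpow.simps(2))
      then show ?thesis
        by (simp only: sum.atMost_Suc) simp
    qed
    also have "(\<Sum>s\<le>n. u z * D s (?j z) * (deriv ^^ (Suc n - s)) f z) =
        (\<Sum>s\<le>Suc n. (case s of 0 \<Rightarrow> 0 | Suc t \<Rightarrow> u z * D t (?j z)) * (deriv ^^ (Suc (Suc n) - s)) f z)"
      by (simp only: sum.atMost_Suc_shift diff_Suc_Suc nat.case mult_zero_left add_0)
    finally show ?thesis
      by (simp only: R_def distrib_right sum.distrib funpow.simps(1) id_apply)
  qed
  moreover have "R 0 x = x 0 ^ Suc (Suc n)" for x
    by (simp add: R_def Q0)
  ultimately show ?case
    by (intro exI[of _ R] conjI allI impI)
qed

section \<open>From multisets of jet indices to the tuples of the expansion\<close>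

lemma finite_multi_indices: "finite (multi_indices s m)"
proof (rule finite_subset)
  show "multi_indices s m \<subseteq> {\<alpha>. \<forall>i. (i \<in> {1..s} \<longrightarrow> \<alpha> i \<in> {..s}) \<and> (i \<notin> {1..s} \<longrightarrow> \<alpha> i = 0)}"
  proof (clarsimp simp: multi_indices_def, goal_cases)
    case (1 \<alpha> i)
    then have "i * \<alpha> i \<le> (\<Sum>i=Suc 0..s. i * \<alpha> i)"
      by (intro member_le_sum) auto
    moreover have "\<alpha> i \<le> i * \<alpha> i"
      using 1 by simp
    ultimately show ?case
      using 1 by linarith
  qed
  show "finite {\<alpha>. \<forall>i. (i \<in> {1..s} \<longrightarrow> \<alpha> i \<in> {..s}) \<and> (i \<notin> {1..s} \<longrightarrow> \<alpha> i = 0)}"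
    by (rule finite_set_of_finite_funs) auto
qed

lemma sum_mset_eq_sum_count:
  fixes M :: "nat multiset"
  assumes "finite A" and "set_mset M \<subseteq> A"
  shows "sum_mset M = (\<Sum>i\<in>A. count M i * i)"
  using assms(2)
proof (induction M)
  case (add a M)
  have "(\<Sum>i\<in>A. count (add_mset a M) i * i) = (\<Sum>i\<in>A. count M i * i + (if i = a then a else 0))"
    by (rule sum.cong) auto
  then show ?case
    using add assms(1) by (simp add: sum.distrib)
qed simp

text \<open>A monomial is determined by the multiplicities of its indices. Those of the positive
  indices form the tuple, m is their total, and the index 0 accounts for the remaining power of
  \<open>x 0\<close>. Positive weight forces m to be at least 1, and every positive index has weight
  at least 1, so m is at most s.\<close>

lemma homog_expansion:
  assumes "homog d s Q" and "1 \<le> s"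
  shows "\<exists>c. \<forall>x. Q x = (\<Sum>m=1..s. x 0 ^ (d - m) *
      (\<Sum>\<alpha>\<in>multi_indices s m. c m \<alpha> * (\<Prod>i=1..s. x i ^ \<alpha> i)))"
  using assms
proof (induction rule: homog.induct)
  case (homog_zero d w)
  show ?case
    by (rule exI[of _ "\<lambda>m \<alpha>. 0"]) simp
next
  case (homog_monomial M d w a)
  \<comment> \<open>The multiplicity of the index 0 is erased, since tuples start at index 1; it
    returns as \<open>d - m\<close>, an exact difference because
    \<open>d = count M 0 + m\<close>.\<close>
  define \<alpha> where "\<alpha> = (\<lambda>i. if i = 0 then 0 else count M i)"
  define m where "m = (\<Sum>i=1..w. \<alpha> i)"
  have M_le: "set_mset M \<subseteq> {..w}"
    using homog_monomial(2) by (auto simp: sum_mset.remove)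
  then have count_0: "count M i = 0" if "i > w" for i
    using that by (meson atMost_iff count_eq_zero_iff linorder_not_le subsetD)
  have split_0: "{..w} = insert 0 {1..w}"
    by auto
  have "w = (\<Sum>i\<in>{..w}. count M i * i)"
    using sum_mset_eq_sum_count[OF finite_atMost M_le] homog_monomial(2) by simp
  then have weight: "(\<Sum>i=1..w. i * \<alpha> i) = w"
    by (simp add: split_0 \<alpha>_def mult.commute)
  have "d = (\<Sum>i\<in>{..w}. count M i)"
    unfolding homog_monomial(1)[symmetric] size_multiset_overloaded_eq
    by (rule sum.mono_neutral_left) (use M_le in \<open>auto simp: not_in_iff\<close>)
  then have d_eq: "d = count M 0 + m"
    by (simp add: split_0 \<alpha>_def m_def)
  have "m \<noteq> 0"
  proof
    assume "m = 0"
    then have "(\<Sum>i=1..w. i * \<alpha> i) = 0"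
      by (simp add: m_def)
    then show False
      using weight homog_monomial(3) by simp
  qed
  have "\<alpha> i \<le> i * \<alpha> i" for i
    by (cases i) (auto simp: \<alpha>_def)
  then have "m \<le> w"
    unfolding m_def by (subst (2) weight[symmetric]) (rule sum_mono)
  with \<open>m \<noteq> 0\<close> have m: "m \<in> {1..w}"
    by auto
  have \<alpha>: "\<alpha> \<in> multi_indices w m"
    using weight by (auto simp: multi_indices_def m_def \<alpha>_def count_0)
  have "(\<Prod>i\<in>#M. x i) = x 0 ^ (d - m) * (\<Prod>i=1..w. x i ^ \<alpha> i)" for x :: "nat \<Rightarrow> complex"
  proof -
    have "(\<Prod>i\<in>#M. x i) = (\<Prod>i\<in>{..w}. x i ^ count M i)"
      unfolding image_prod_mset_multiplicity
      by (rule prod.mono_neutral_left) (use M_le in \<open>auto simp: not_in_iff\<close>)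
    then show ?thesis
      by (simp add: split_0 \<alpha>_def d_eq)
  qed
  moreover have "(\<Sum>m'=1..w. x 0 ^ (d - m') * (\<Sum>\<beta>\<in>multi_indices w m'.
      (if m' = m \<and> \<beta> = \<alpha> then a else 0) * (\<Prod>i=1..w. x i ^ \<beta> i))) =
      x 0 ^ (d - m) * (a * (\<Prod>i=1..w. x i ^ \<alpha> i))" for x :: "nat \<Rightarrow> complex"
  proof -
    have "(\<Sum>\<beta>\<in>multi_indices w m'.
        (if m' = m \<and> \<beta> = \<alpha> then a else 0) * (\<Prod>i=1..w. x i ^ \<beta> i)) =
        (if m' = m then a * (\<Prod>i=1..w. x i ^ \<alpha> i) else 0)" for m'
      using \<alpha> finite_multi_indices[of w m] by (simp add: if_distrib[of "\<lambda>t. t * _"] sum.delta cong: if_cong)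
    then show ?thesis
      using m by (simp add: if_distrib[of "\<lambda>t. _ * t"] sum.delta cong: if_cong)
  qed
  ultimately show ?case
    by (intro exI[of _ "\<lambda>m' \<beta>. if m' = m \<and> \<beta> = \<alpha> then a else 0"]) (simp add: mult_ac)
next
  case (homog_add d w Q R)
  then obtain b c where
    "\<And>x. Q x = (\<Sum>m=1..w. x 0 ^ (d - m) *
      (\<Sum>\<alpha>\<in>multi_indices w m. b m \<alpha> * (\<Prod>i=1..w. x i ^ \<alpha> i)))"
    "\<And>x. R x = (\<Sum>m=1..w. x 0 ^ (d - m) *
      (\<Sum>\<alpha>\<in>multi_indices w m. c m \<alpha> * (\<Prod>i=1..w. x i ^ \<alpha> i)))"
    by blast
  then show ?case
    by (intro exI[of _ "\<lambda>m \<alpha>. b m \<alpha> + c m \<alpha>"]) (simp add: distrib_left distrib_right sum.distrib)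
qed

lemma expands_power_exists:
  assumes "k \<ge> 1"
  shows "\<exists>c. expands_power k c"
proof -
  obtain n where k: "k = Suc n"
    using assms by (cases k) auto
  obtain Q where Q0: "\<And>x. Q 0 x = x 0 ^ k"
    and Q: "\<And>s. s \<le> n \<Longrightarrow> homog k s (Q s)"
    and eq: "\<And>u f z. u analytic_on {z} \<Longrightarrow> f analytic_on {z} \<Longrightarrow>
        (diff_op u ^^ k) f z =
          (\<Sum>s\<le>n. Q s (\<lambda>i. (deriv ^^ i) u z) * (deriv ^^ (k - s)) f z)"
    using diff_op_power_homog[of n] unfolding k by blast
  have "\<forall>s\<in>{1..n}. \<exists>c. \<forall>x. Q s x = (\<Sum>m=1..s. x 0 ^ (k - m) *
      (\<Sum>\<alpha>\<in>multi_indices s m. c m \<alpha> * (\<Prod>i=1..s. x i ^ \<alpha> i)))"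
    using homog_expansion[OF Q] by simp
  from bchoice[OF this] obtain c where c: "\<forall>s\<in>{1..n}. \<forall>x. Q s x = (\<Sum>m=1..s. x 0 ^ (k - m) *
      (\<Sum>\<alpha>\<in>multi_indices s m. c s m \<alpha> * (\<Prod>i=1..s. x i ^ \<alpha> i)))" ..
  have split_0: "{..n} = insert 0 {1..k - 1}"
    using k by auto
  have "expands_power k c"
    unfolding expands_power_def
  proof (intro allI impI, goal_cases)
    case (1 u f z)
    show ?case
      unfolding eq[OF 1(3,4)] split_0 using k
      by (subst sum.insert) (auto simp: Q0 c intro!: sum.cong simp del: funpow.simps(2))
  qed
  then show ?thesis
    by blast
qed

subsection \<open>Uniqueness of the coefficients\<close>

text \<open>Induction on the variables: with all but \<open>x j\<close> frozen, the sum is a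
  polynomial in one variable that vanishes everywhere, so each of its coefficients vanishes. The
  coefficient at exponent \<open>\<alpha> j\<close> is a sum of the same kind over the exponents
  that agree with \<alpha> at j. With no variables left, only one exponent remains.\<close>

lemma monomials_linearly_independent:
  fixes d :: "('a \<Rightarrow> nat) \<Rightarrow> complex"
  assumes "finite I" and "finite A"
    and "\<And>\<alpha> \<beta>. \<alpha> \<in> A \<Longrightarrow> \<beta> \<in> A \<Longrightarrow> (\<And>i. i \<in> I \<Longrightarrow> \<alpha> i = \<beta> i) \<Longrightarrow> \<alpha> = \<beta>"
    and "\<And>x. (\<Sum>\<alpha>\<in>A. d \<alpha> * (\<Prod>i\<in>I. x i ^ \<alpha> i)) = 0"
    and "\<alpha> \<in> A"
  shows "d \<alpha> = 0"
  using assms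
proof (induction I arbitrary: A rule: finite_induct)
  case empty
  then have "A = {\<alpha>}"
    by blast
  with empty.prems(3) show ?case
    by simp
next
  case (insert j I)
  define B where "B = {\<beta> \<in> A. \<beta> j = \<alpha> j}"
  have "(\<Sum>\<beta>\<in>B. d \<beta> * (\<Prod>i\<in>I. x i ^ \<beta> i)) = 0" for x
  proof -
    let ?p = "\<Sum>\<beta>\<in>A. monom (d \<beta> * (\<Prod>i\<in>I. x i ^ \<beta> i)) (\<beta> j)"
    have "poly ?p t = 0" for t
    proof -
      have "(\<Prod>i\<in>I. (x(j := t)) i ^ \<beta> i) = (\<Prod>i\<in>I. x i ^ \<beta> i)" for \<beta>
        using insert.hyps by (intro prod.cong) auto
      then show ?thesis
        using insert.prems(3)[of "x(j := t)"] insert.hyps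
        by (simp add: poly_sum poly_monom mult_ac)
    qed
    then have "?p = 0"
      using poly_all_0_iff_0 by blast
    then have "coeff ?p (\<alpha> j) = 0"
      by (simp only: coeff_0)
    then show ?thesis
      using insert.prems(1) by (simp add: coeff_sum B_def sum.inter_filter)
  qed
  moreover have "finite B" "\<alpha> \<in> B"
    using insert.prems by (auto simp: B_def)
  moreover have "\<beta> = \<gamma>" if "\<beta> \<in> B" "\<gamma> \<in> B" "\<And>i. i \<in> I \<Longrightarrow> \<beta> i = \<gamma> i" for \<beta> \<gamma>
    using that by (intro insert.prems(2)) (auto simp: B_def)
  ultimately show ?case
    using insert.IH[of B] by blast
qed

section \<open>Polynomials as test functions\<close>

lemma poly_meromorphic: "poly p meromorphic_on UNIV"
  and poly_analytic: "poly (p :: complex poly) analytic_on A"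
proof -
  have "poly p holomorphic_on UNIV"
    by (meson holomorphic_onI field_differentiable_def has_field_derivative_at_within poly_DERIV)
  then have "poly p analytic_on UNIV"
    by (simp add: analytic_on_open)
  then show "poly p meromorphic_on UNIV" "poly p analytic_on A"
    by (auto intro: analytic_on_imp_meromorphic_on analytic_on_subset)
qed

lemma higher_deriv_poly: "(deriv ^^ n) (poly p) = poly ((pderiv ^^ n) (p :: complex poly))"
  by (induction n) (auto intro!: ext DERIV_imp_deriv)

text \<open>The Taylor polynomial with the given data. It lets the derivatives at 0 be treated as
  independent variables.\<close>

lemma polynomial_with_jet:
  fixes y :: "nat \<Rightarrow> complex"
  shows "\<exists>p. \<forall>i\<le>n. (deriv ^^ i) (poly p) 0 = y i"
proof (intro exI allI impI)
  let ?p = "\<Sum>i\<le>n. monom (y i / fact i) i"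
  show "(deriv ^^ i) (poly ?p) 0 = y i" if "i \<le> n" for i
    using that by (simp add: higher_deriv_poly poly_0_coeff_0 coeff_higher_pderiv coeff_sum pochhammer_fact[symmetric])
qed

text \<open>Evaluating at \<open>0\<close> with \<open>f = z\<^sup>k\<^sup>-\<^sup>s / (k - s)!\<close> isolates the coefficient of \<open>(d/dz)\<^sup>k\<^sup>-\<^sup>s\<close>.\<close>

lemma expands_power_coefficient:
  assumes "expands_power k c" and "u meromorphic_on UNIV" and "u analytic_on {0}"
    and "1 \<le> s" and "s \<le> k - 1"
    and "\<forall>i\<le>k. (deriv ^^ i) (poly p) 0 = (if i = k - s then 1 else 0)"
  shows "(diff_op u ^^ k) (poly p) 0 = (\<Sum>m=1..s. u 0 ^ (k - m) *
      (\<Sum>\<alpha>\<in>multi_indices s m. c s m \<alpha> * (\<Prod>i=1..s. (deriv ^^ i) u 0 ^ \<alpha> i)))"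
proof -
  let ?F = "\<lambda>s. \<Sum>m=1..s. u 0 ^ (k - m) *
      (\<Sum>\<alpha>\<in>multi_indices s m. c s m \<alpha> * (\<Prod>i=1..s. (deriv ^^ i) u 0 ^ \<alpha> i))"
  have "(diff_op u ^^ k) (poly p) 0 =
      u 0 ^ k * (deriv ^^ k) (poly p) 0 + (\<Sum>t=1..k-1. ?F t * (deriv ^^ (k - t)) (poly p) 0)"
    using assms(1-3) unfolding expands_power_def by (blast intro: poly_meromorphic poly_analytic)
  also have "(\<Sum>t=1..k-1. ?F t * (deriv ^^ (k - t)) (poly p) 0) = (\<Sum>t=1..k-1. if t = s then ?F t else 0)"
    using assms(4,5) by (intro sum.cong) (auto simp: assms(6))
  also have "\<dots> = ?F s"
    using assms(4,5) by simp
  also have "(deriv ^^ k) (poly p) 0 = 0"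
    using assms(4-6) by auto
  finally show ?thesis
    by simp
qed

text \<open>Both families compute the same coefficient of A to the power k for every polynomial u.
  Taking u(0) = 1 removes the powers of u, while the derivatives of order 1 to s remain free, so the
  difference is a vanishing polynomial in s variables and its coefficients are zero.\<close>

lemma expands_power_unique:
  assumes b: "expands_power k b" and c: "expands_power k c"
    and s: "1 \<le> s" "s \<le> k - 1" and m: "1 \<le> m" "m \<le> s" and \<alpha>: "\<alpha> \<in> multi_indices s m"
  shows "b s m \<alpha> = c s m \<alpha>"
proof -
  \<comment> \<open>The degree m is recovered from the tuple as the sum of its entries, so the
    double sum over m and \<beta> becomes one sum over a disjoint union.\<close>
  define d where "d = (\<lambda>\<beta>. b s (sum \<beta> {1..s}) \<beta> - c s (sum \<beta> {1..s}) \<beta>)"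
  have deg: "sum \<beta> {1..s} = m" if "\<beta> \<in> multi_indices s m" for \<beta> m
    using that by (simp add: multi_indices_def)
  have d_eq: "d \<beta> = b s m \<beta> - c s m \<beta>" if "\<beta> \<in> multi_indices s m" for \<beta> m
    using deg[OF that] by (simp add: d_def)
  let ?A = "\<Union>m\<in>{1..s}. multi_indices s m"
  have vanish: "(\<Sum>\<beta>\<in>?A. d \<beta> * (\<Prod>i\<in>{1..s}. x i ^ \<beta> i)) = 0" for x :: "nat \<Rightarrow> complex"
  proof -
    obtain q where q: "\<And>i. i \<le> s \<Longrightarrow> (deriv ^^ i) (poly q) 0 = (x(0 := 1)) i"
      using polynomial_with_jet[of s "x(0 := 1)"] by blast
    obtain p where p: "\<forall>i\<le>k. (deriv ^^ i) (poly p) (0 :: complex) = (if i = k - s then 1 else 0)"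
      using polynomial_with_jet[of k "\<lambda>i. if i = k - s then 1 else 0"] by blast
    have q0: "poly q 0 = 1"
      using q[of 0] by simp
    have at_jet: "(diff_op (poly q) ^^ k) (poly p) 0 =
        (\<Sum>m=1..s. \<Sum>\<beta>\<in>multi_indices s m. a s m \<beta> * (\<Prod>i=1..s. x i ^ \<beta> i))"
      if "expands_power k a" for a
      unfolding expands_power_coefficient[OF that poly_meromorphic poly_analytic s p] q0
      by (intro sum.cong refl) (auto simp: q intro!: sum.cong prod.cong)
    have "(\<Sum>\<beta>\<in>?A. d \<beta> * (\<Prod>i\<in>{1..s}. x i ^ \<beta> i)) =
        (\<Sum>m=1..s. \<Sum>\<beta>\<in>multi_indices s m. d \<beta> * (\<Prod>i\<in>{1..s}. x i ^ \<beta> i))"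
      by (intro sum.UNION_disjoint) (auto simp: finite_multi_indices dest!: deg)
    also have "\<dots> = (\<Sum>m=1..s. \<Sum>\<beta>\<in>multi_indices s m. b s m \<beta> * (\<Prod>i=1..s. x i ^ \<beta> i)) -
        (\<Sum>m=1..s. \<Sum>\<beta>\<in>multi_indices s m. c s m \<beta> * (\<Prod>i=1..s. x i ^ \<beta> i))"
      unfolding sum_subtractf[symmetric]
      by (intro sum.cong refl, subst d_eq, assumption) (rule left_diff_distrib)
    also have "\<dots> = 0"
      using at_jet[OF b] at_jet[OF c] by simp
    finally show ?thesis .
  qed
  have distinct: "\<beta> = \<gamma>" if "\<beta> \<in> ?A" "\<gamma> \<in> ?A" "\<And>i. i \<in> {1..s} \<Longrightarrow> \<beta> i = \<gamma> i" for \<beta> \<gamma>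
  proof
    show "\<beta> i = \<gamma> i" for i
      using that by (cases "i \<in> {1..s}") (auto simp: multi_indices_def)
  qed
  have "\<alpha> \<in> ?A"
    using \<alpha> m by auto
  moreover have "finite ?A"
    by (simp add: finite_multi_indices)
  ultimately have "d \<alpha> = 0"
    using monomials_linearly_independent[OF finite_atLeastAtMost _ distinct vanish] by blast
  then show ?thesis
    using d_eq[OF \<alpha>] by simp
qed

text \<open>Justifies the definite description: any expansion, set to 0 outside the admissible
  indices, is a witness, and inside them the coefficients are unique.\<close>

lemma coeff_C_properties:
  assumes "k \<ge> 1"
  shows expands_power_coeff_C: "expands_power k (coeff_C k)"
    and coeff_C_eq_0: "\<not> (1 \<le> s \<and> s \<le> k - 1 \<and> 1 \<le> m \<and> m \<le> s \<and> \<alpha> \<in> multi_indices s m) \<Longrightarrow>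
      coeff_C k s m \<alpha> = 0"
proof -
  let ?ok = "\<lambda>s m \<alpha>. 1 \<le> s \<and> s \<le> k - 1 \<and> 1 \<le> m \<and> m \<le> s \<and> \<alpha> \<in> multi_indices s m"
  let ?P = "\<lambda>c. expands_power k c \<and> (\<forall>s m \<alpha>. \<not> ?ok s m \<alpha> \<longrightarrow> c s m \<alpha> = 0)"
  obtain b where b: "expands_power k b"
    using expands_power_exists[OF assms] by blast
  define c where "c = (\<lambda>s m \<alpha>. if ?ok s m \<alpha> then b s m \<alpha> else 0)"
  \<comment> \<open>The identity only reads admissible indices, so the truncation does not change
    it, whatever the jets \<open>v\<close> and \<open>w\<close> are.\<close>
  have sum_eq: "(\<Sum>s=1..k-1. (\<Sum>m=1..s. v 0 ^ (k - m) *
        (\<Sum>\<alpha>\<in>multi_indices s m. c s m \<alpha> * (\<Prod>i=1..s. v i ^ \<alpha> i))) * w s) =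
      (\<Sum>s=1..k-1. (\<Sum>m=1..s. v 0 ^ (k - m) *
        (\<Sum>\<alpha>\<in>multi_indices s m. b s m \<alpha> * (\<Prod>i=1..s. v i ^ \<alpha> i))) * w s)"
    for v w :: "nat \<Rightarrow> complex"
    by (intro sum.cong arg_cong2[where f = "(*)"] refl) (auto simp: c_def)
  have "expands_power k c"
    unfolding expands_power_def
  proof (intro allI impI, goal_cases)
    case (1 u f z)
    then show ?case
      using b sum_eq[of "\<lambda>i. (deriv ^^ i) u z" "\<lambda>s. (deriv ^^ (k - s)) f z"]
      unfolding expands_power_def by simp
  qed
  then have "?P c"
    by (simp add: c_def)
  moreover have "c' = c" if "?P c'" for c'
  proof (intro ext)
    show "c' s m \<alpha> = c s m \<alpha>" for s m \<alpha>
      using that \<open>?P c\<close> expands_power_unique[of k c' c s m \<alpha>] by (cases "?ok s m \<alpha>") auto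
  qed
  ultimately have "?P (coeff_C k)"
    unfolding coeff_C_def by (rule theI)
  then show "expands_power k (coeff_C k)" "\<not> ?ok s m \<alpha> \<Longrightarrow> coeff_C k s m \<alpha> = 0"
    by blast+
qed

subsection \<open>The powers of \<open>(1 - z)\<^sup>-\<^sup>1 d/dz\<close>\<close>

text \<open>The closed form of the numbers a(k, s) of the opening comment. For k at least 1 these
  are the coefficients of the Bessel polynomial of degree k - 1.\<close>

definition power_coeff :: "nat \<Rightarrow> nat \<Rightarrow> complex" where
  "power_coeff k s = of_int (double_fact (2 * int s - 1)) * of_nat ((k + s - 1) choose (2 * s))"

lemma double_fact_odd_Suc:
  "double_fact (2 * int (Suc s) - 1) = (2 * int s + 1) * double_fact (2 * int s - 1)"
proof -
  let ?S = "{j. 1 \<le> j \<and> j \<le> 2 * int s - 1 \<and> even (2 * int s - 1 - j)}"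
  have "{j. 1 \<le> j \<and> j \<le> 2 * int (Suc s) - 1 \<and> even (2 * int (Suc s) - 1 - j)} =
      insert (2 * int s + 1) ?S"
    by (auto; presburger)
  moreover have "finite ?S"
    by (rule finite_subset[of _ "{1..2 * int s - 1}"]) auto
  ultimately show ?thesis
    by (simp add: double_fact_def)
qed

lemma power_coeff_0: "power_coeff k 0 = 1"
proof -
  have "{j :: int. 1 \<le> j \<and> j \<le> 2 * int 0 - 1 \<and> even (2 * int 0 - 1 - j)} = {}"
    by auto
  then show ?thesis
    by (simp only: power_coeff_def double_fact_def) simp
qed

lemma power_coeff_Suc:
  "power_coeff (Suc k) (Suc s) = power_coeff k (Suc s) + of_nat (k + s) * power_coeff k s"
proof -
  \<comment> \<open>Pascal's rule splits off the binomial with lower index 2s + 1. Its factor 2s +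
    1, the new factor of the double factorial, is absorbed to reach the lower index 2s.\<close>
  have "(2 * s + 1) * ((k + s) choose (2 * s + 1)) = (k + s) * ((k + s - 1) choose (2 * s))"
    using times_binomial_minus1_eq[of "2 * s + 1" "k + s"] by simp
  then have absorb: "(2 * of_nat s + 1) * of_nat ((k + s) choose (2 * s + 1)) =
      (of_nat (k + s) * of_nat ((k + s - 1) choose (2 * s)) :: complex)"
    by (metis (no_types, lifting) of_nat_1 of_nat_add of_nat_mult of_nat_numeral)
  have "power_coeff (Suc k) (Suc s) = power_coeff k (Suc s) +
      of_int (double_fact (2 * int s - 1)) * ((2 * of_nat s + 1) * of_nat ((k + s) choose (2 * s + 1)))"
    unfolding power_coeff_def double_fact_odd_Suc by (simp add: algebra_simps)
  then show ?thesis
    unfolding absorb by (simp add: power_coeff_def)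
qed

text \<open>The upper index k + s - 1 lies below 2s. The case k = s = 0 must be excluded: there the
  value is 1.\<close>

lemma power_coeff_eq_0:
  assumes "k < s \<or> k = s \<and> 1 \<le> k"
  shows "power_coeff k s = 0"
  using assms by (auto simp: power_coeff_def binomial_eq_0)

section \<open>Derivatives of \<open>inverse (1 - z)\<close> and the powers of its operator\<close>

lemma inverse_power_has_field_derivative:
  fixes z :: complex
  assumes "z \<noteq> 1"
  shows "((\<lambda>y. inverse (1 - y) ^ n) has_field_derivative of_nat n * inverse (1 - z) ^ Suc n) (at z)"
proof -
  have "((\<lambda>y. inverse (1 - y)) has_field_derivative inverse (1 - z) ^ 2) (at z)"
    using assms by (auto intro!: derivative_eq_intros simp: power2_eq_square)
  from DERIV_power[OF this, of n] show ?thesis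
    by (cases n) (simp_all add: power2_eq_square mult_ac)
qed

text \<open>Iterates v' = v^2 for v = \<open>inverse (1 - z)\<close>. A general point is needed
  because the induction step differentiates on a neighbourhood; at 0 the value is
  \<open>fact n\<close>.\<close>

lemma higher_deriv_geometric:
  fixes z :: complex
  assumes "z \<noteq> 1"
  shows "(deriv ^^ n) (\<lambda>y. inverse (1 - y)) z = fact n * inverse (1 - z) ^ Suc n"
  using assms
proof (induction n arbitrary: z)
  case (Suc n)
  have "eventually (\<lambda>y. y \<noteq> 1) (nhds z)"
    using Suc.prems by (simp add: t1_space_nhds)
  then have "eventually (\<lambda>y. (deriv ^^ n) (\<lambda>y. inverse (1 - y)) y = fact n * inverse (1 - y) ^ Suc n) (nhds z)"
    by eventually_elim (use Suc.IH in blast)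
  from deriv_cong_ev[OF this refl]
  have "(deriv ^^ Suc n) (\<lambda>y. inverse (1 - y)) z = deriv (\<lambda>y. fact n * inverse (1 - y) ^ Suc n) z"
    by simp
  also have "\<dots> = fact n * (of_nat (Suc n) * inverse (1 - z) ^ Suc (Suc n))"
    by (intro DERIV_imp_deriv DERIV_cmult inverse_power_has_field_derivative Suc.prems)
  finally show ?case
    by (simp add: mult_ac)
qed simp

text \<open>Since v' = v^2, A sends v^(k+s) f^(k-s) to v^(k+1+s) f^(k+1-s) + (k+s) v^(k+s+2)
  f^(k-s). The second term belongs to the index s + 1, and collecting terms gives the recursion
  \<open>power_coeff_Suc\<close>.\<close>

lemma diff_op_geometric_power:
  assumes "z \<noteq> 1"
  shows "(diff_op (\<lambda>y. inverse (1 - y)) ^^ k) (poly p) z =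
    (\<Sum>s\<le>k. power_coeff k s * inverse (1 - z) ^ (k + s) * (deriv ^^ (k - s)) (poly p) z)"
  using assms
proof (induction k arbitrary: z)
  case 0
  then show ?case
    by (simp add: power_coeff_0)
next
  case (Suc k)
  let ?A = "diff_op (\<lambda>y. inverse (1 - y))" and ?v = "inverse (1 - z)"
  let ?f = "\<lambda>n. (deriv ^^ n) (poly p) z"
  let ?g = "\<lambda>y. \<Sum>s\<le>k. power_coeff k s * inverse (1 - y) ^ (k + s) * (deriv ^^ (k - s)) (poly p) y"
  let ?D = "\<Sum>s\<le>k. power_coeff k s * ?v ^ (k + s) * ?f (Suc (k - s)) +
      power_coeff k s * (of_nat (k + s) * ?v ^ Suc (k + s)) * ?f (k - s)"
  have "eventually (\<lambda>y. y \<noteq> 1) (nhds z)"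
    using Suc.prems by (simp add: t1_space_nhds)
  then have "eventually (\<lambda>y. (?A ^^ k) (poly p) y = ?g y) (nhds z)"
    by eventually_elim (use Suc.IH in blast)
  from deriv_cong_ev[OF this refl] have "deriv ((?A ^^ k) (poly p)) z = deriv ?g z" .
  also have "\<dots> = ?D"
    by (intro DERIV_imp_deriv DERIV_sum DERIV_mult' DERIV_cmult inverse_power_has_field_derivative
        Suc.prems higher_deriv_has_field_derivative poly_analytic)
  finally have "(?A ^^ Suc k) (poly p) z = ?v * ?D"
    by (simp add: diff_op_def[of "\<lambda>y. inverse (1 - y)" "(?A ^^ k) (poly p)"])
  also have "\<dots> = (\<Sum>s\<le>k. power_coeff k s * ?v ^ (Suc k + s) * ?f (Suc k - s)) +
      (\<Sum>s\<le>k. of_nat (k + s) * power_coeff k s * ?v ^ (Suc k + Suc s) * ?f (Suc k - Suc s))"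
    unfolding sum_distrib_left sum.distrib[symmetric]
    by (intro sum.cong refl) (simp add: Suc_diff_le algebra_simps)
  \<comment> \<open>The added top term is zero. It is needed so that, after splitting off s = 0 and
    shifting, both sums run over the same range.\<close>
  also have "(\<Sum>s\<le>k. power_coeff k s * ?v ^ (Suc k + s) * ?f (Suc k - s)) =
      (\<Sum>s\<le>Suc k. power_coeff k s * ?v ^ (Suc k + s) * ?f (Suc k - s))"
    by (simp add: power_coeff_eq_0)
  also have "\<dots> = ?v ^ Suc k * ?f (Suc k) +
      (\<Sum>s\<le>k. power_coeff k (Suc s) * ?v ^ (Suc k + Suc s) * ?f (Suc k - Suc s))"
    by (subst sum.atMost_Suc_shift) (simp add: power_coeff_0)
  finally have "(?A ^^ Suc k) (poly p) z = ?v ^ Suc k * ?f (Suc k) +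
      (\<Sum>s\<le>k. power_coeff (Suc k) (Suc s) * ?v ^ (Suc k + Suc s) * ?f (Suc k - Suc s))"
    unfolding power_coeff_Suc by (simp only: distrib_right sum.distrib add.assoc)
  also have "\<dots> = (\<Sum>s\<le>Suc k. power_coeff (Suc k) s * ?v ^ (Suc k + s) * ?f (Suc k - s))"
    by (subst sum.atMost_Suc_shift) (simp add: power_coeff_0)
  finally show ?case .
qed

section \<open>Comparison of the two expansions at the origin\<close>

theorem corollary3p4:
  fixes k s :: nat
  assumes "k \<ge> 1" and "s \<le> k"
  shows "double_sum s (\<lambda>m \<alpha>. (\<Prod>i=1..s. fact i ^ \<alpha> i) * coeff_C k s m \<alpha>)
       = of_int (double_fact (2 * int s - 1)) * of_nat ((k + s - 1) choose (2 * s))"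
proof -
  consider "s = 0" | "s = k" "s \<noteq> 0" | "1 \<le> s" "s \<le> k - 1"
    using assms by linarith
  then have "double_sum s (\<lambda>m \<alpha>. (\<Prod>i=1..s. fact i ^ \<alpha> i) * coeff_C k s m \<alpha>) = power_coeff k s"
  proof cases
    case 1
    then show ?thesis
      by (simp add: double_sum_def power_coeff_0)
  next
    \<comment> \<open>Both sides vanish: the left by the convention for the coefficients with s = k,
      the right because 2k - 1 < 2k.\<close>
    case 2
    then show ?thesis
      using assms(1) by (simp add: double_sum_def power_coeff_eq_0 coeff_C_eq_0)
  next
    case 3
    let ?u = "\<lambda>y :: complex. inverse (1 - y)"
    obtain p where p: "\<forall>i\<le>k. (deriv ^^ i) (poly p) (0 :: complex) = (if i = k - s then 1 else 0)"
      using polynomial_with_jet[of k "\<lambda>i. if i = k - s then 1 else 0"] by blast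
    \<comment> \<open>The pole at 1 is harmless, since the expansion is evaluated only at 0, where u
      has value 1 and i-th derivative i!.\<close>
    have u: "?u meromorphic_on UNIV" "?u analytic_on {0}"
      by (auto intro!: meromorphic_intros analytic_intros)
    have "(\<Sum>m=1..s. \<Sum>\<alpha>\<in>multi_indices s m. (\<Prod>i=1..s. fact i ^ \<alpha> i) * coeff_C k s m \<alpha>) =
        (diff_op ?u ^^ k) (poly p) 0"
      unfolding expands_power_coefficient[OF expands_power_coeff_C[OF assms(1)] u 3 p]
      by (simp add: higher_deriv_geometric mult.commute)
    \<comment> \<open>At 0 all powers of \<open>inverse (1 - z)\<close> are 1, and the jet of p
      selects k - t = k - s, which means t = s because both are at most k.\<close>
    also have "\<dots> = (\<Sum>t\<le>k. if t = s then power_coeff k t else 0)"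
      unfolding diff_op_geometric_power[OF zero_neq_one]
      using assms(2) by (intro sum.cong) (auto simp: p)
    also have "\<dots> = power_coeff k s"
      using assms(2) by simp
    finally show ?thesis
      using 3 by (simp add: double_sum_def)
  qed
  then show ?thesis
    by (simp add: power_coeff_def)
qed

end
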